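(* Let $\Theta$ and $\mathcal C$ be the polyhedra $\Theta=\{x\in\mathbb R^n\mid \langle a_i,x\rangle\le b_i\ \forall i\in I_1\}$ and $\mathcal C=\{x\in\mathbb R^n\mid \langle a_i,x\rangle\le 0\ \forall i\in I_2\}$, and let $\mathcal N$ be the normal cone mapping to $\Theta$. Let $\bar x\in\mathcal C$ and $(\bar x,\bar x^* )\in\operatorname{gph}\mathcal N$. Then the Fréchet normal cone with respect to $\mathcal C\times\mathbb R^n$ of $\operatorname{gph}\mathcal N$ at $(\bar x,\bar x^* )$ is given by $$\hat N_{\mathcal C\times\mathbb R^n}((\bar x,\bar x^* ),\operatorname{gph}\mathcal N)=\Big(\big(T(\bar x,\Theta\cap\mathcal C)\cap\{\bar x^*\}^{\perp}\big)^{\circ}\cap T(\bar x,\mathcal C)\Big)\times\Big(T(\bar x,\Theta)\cap\{\bar x^*\}^{\perp}\Big)=(A_{\bar I,\tilde I}\cap\mathcal T_{\bar I_2})\times B_{\bar I_1,\tilde I},$$ where $\bar I:=I(\bar x)$, $\bar I_1:=I_1(\bar x)$, $\bar I_2:=I_2(\bar x)$ and $\tilde I:=\mathcal I(\bar x,\bar x^* )$.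
   Context: Setting: $I_1=\{1,\dots,\ell_1\}$, $I_2=\{\ell_1+1,\dots,\ell\}$, $I=I_1\cup I_2$; $a_i\in\mathbb R^n$ for $i\in I$ and $b_i\in\mathbb R$ for $i\in I_1$. Active index sets: $I_1(x)=\{i\in I_1\mid\langle a_i,x\rangle=b_i\}$ for $x\in\Theta$; $I_2(x)=\{i\in I_2\mid\langle a_i,x\rangle=0\}$ for $x\in\mathcal C$; $I(x)=I_1(x)\cup I_2(x)$ for $x\in\Theta\cap\mathcal C$. Normal cone mapping: $\mathcal N(x)=N(x,\Theta)$ (the usual normal cone to the convex set $\Theta$, equal to $\operatorname{cone}\{a_i\mid i\in I_1(x)\}$) if $x\in\Theta$, and $\mathcal N(x)=\emptyset$ otherwise; $\operatorname{gph}\mathcal N=\{(x,x^* )\mid x^*\in\mathcal N(x)\}$. $T(x,\Omega)$ is the tangent (contingent) cone; $K^\circ=\{u\mid \langle u,w\rangle\le 0\ \forall w\in K\}$ is the polar cone; $\{x^*\}^\perp=\{w\mid\langle x^*,w\rangle=0\}$. Index set $\mathcal I(\bar x,\bar x^* )$: since $\bar x^*\in N(\bar x,\Theta)$, there are a set $\mathcal I\subset I_1(\bar x)$ and numbers $\lambda_i\ge 0$ ($i\in\mathcal I$) with $\bar x^*=\sum_{i\in\mathcal I}\lambda_ia_i$; fixing such a representation, $\mathcal I(\bar x,\bar x^* ):=\{i\in\mathcal I\mid\lambda_i>0\}$. For $P\subset Q\subset I$ with $P\subset I_1$: $\mathcal T_Q=\{u\in\mathbb R^n\mid\langle a_i,u\rangle\le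 0\ \forall i\in Q\}$ (defined for every $Q\subset I$), $B_{Q,P}=\{u\in\mathcal T_Q\mid\langle a_i,u\rangle=0\ \forall i\in P\}$, $A_{Q,P}=\operatorname{cone}\{a_i\mid i\in Q\setminus P\}+\operatorname{span}\{a_i\mid i\in P\}$. Here $\operatorname{cone}$ is the convex cone generated (nonnegative combinations), $\operatorname{cone}\emptyset=\operatorname{span}\emptyset=\{0\}$, $\mathcal T_\emptyset=\mathbb R^n$. Fréchet normal cone with respect to a set: for nonempty $\Omega,\mathcal D\subset\mathbb R^s$ with $\mathcal D$ closed and convex, and $\bar z\in\Omega\cap\mathcal D$, $$\hat N_{\mathcal D}(\bar z,\Omega)=\Big\{z^*\in\mathbb R^s\ \Big|\ \exists p>0:\ \bar z+pz^*\in\mathcal D,\ \limsup_{z\to\bar z,\ z\in\Omega\cap\mathcal D}\frac{\langle z^*,z-\bar z\rangle}{\|z-\bar z\|}\le 0\Big\}.$$ *)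

theory Defs
  imports "HOL-Analysis.Analysis"
begin

definition polar :: "'a::real_inner set \<Rightarrow> 'a set" where
  "polar K = {u. \<forall>w\<in>K. u \<bullet> w \<le> 0}"

definition orth :: "'a::real_inner \<Rightarrow> 'a set" where
  "orth xs = {w. xs \<bullet> w = 0}"

definition tangent_cone :: "'a::real_normed_vector \<Rightarrow> 'a set \<Rightarrow> 'a set" where
  "tangent_cone x \<Omega> =
    {w. \<exists>t v. (\<forall>k::nat. 0 < t k) \<and> t \<longlonglongrightarrow> (0::real) \<and> v \<longlonglongrightarrow> w \<and>
              (\<forall>k. x + t k *\<^sub>R v k \<in> \<Omega>)}"

definition normal_cone :: "'a::real_inner \<Rightarrow> 'a set \<Rightarrow> 'a set" where
  "normal_cone x \<Theta> = {xs. \<forall>y\<in>\<Theta>. xs \<bullet> (y - x) \<le> 0}"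

definition normal_cone_map :: "'a::real_inner set \<Rightarrow> 'a \<Rightarrow> 'a set" where
  "normal_cone_map \<Theta> x = (if x \<in> \<Theta> then normal_cone x \<Theta> else {})"

definition gph :: "('a \<Rightarrow> 'b set) \<Rightarrow> ('a \<times> 'b) set" where
  "gph F = {(x, y). y \<in> F x}"

text \<open>The upper limit is taken in the extended reals, so it is \<open>-\<infinity>\<close>, and the inequality
  holds, when \<open>z\<close> is an isolated point of \<open>\<Omega> \<inter> D\<close>.\<close>

definition frechet_normal_cone_wrt :: "'a::real_inner set \<Rightarrow> 'a \<Rightarrow> 'a set \<Rightarrow> 'a set" where
  "frechet_normal_cone_wrt D z \<Omega> =
    {zs. (\<exists>p>0. z + p *\<^sub>R zs \<in> D) \<and>
         Limsup (at z within (\<Omega> \<inter> D)) (\<lambda>y. ereal ((zs \<bullet> (y - z)) / norm (y - z))) \<le> 0}"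

definition active :: "('i \<Rightarrow> 'a::real_inner) \<Rightarrow> ('i \<Rightarrow> real) \<Rightarrow> 'i set \<Rightarrow> 'a \<Rightarrow> 'i set" where
  "active a b J x = {i\<in>J. a i \<bullet> x = b i}"

definition cone_T :: "('i \<Rightarrow> 'a::real_inner) \<Rightarrow> 'i set \<Rightarrow> 'a set" where
  "cone_T a Q = {u. \<forall>i\<in>Q. a i \<bullet> u \<le> 0}"

definition cone_B :: "('i \<Rightarrow> 'a::real_inner) \<Rightarrow> 'i set \<Rightarrow> 'i set \<Rightarrow> 'a set" where
  "cone_B a Q P = {u \<in> cone_T a Q. \<forall>i\<in>P. a i \<bullet> u = 0}"

definition cone_A :: "('i \<Rightarrow> 'a::real_inner) \<Rightarrow> 'i set \<Rightarrow> 'i set \<Rightarrow> 'a set" where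
  "cone_A a Q P = convex_cone hull (a ` (Q - P)) + span (a ` P)"

definition represents ::
  "('i \<Rightarrow> 'a::real_inner) \<Rightarrow> 'i set \<Rightarrow> 'a \<Rightarrow> 'i set \<Rightarrow> ('i \<Rightarrow> real) \<Rightarrow> bool" where
  "represents a Q xs J lam \<longleftrightarrow>
    J \<subseteq> Q \<and> (\<forall>i\<in>J. 0 \<le> lam i) \<and> xs = (\<Sum>i\<in>J. lam i *\<^sub>R a i)"

definition pos_indices :: "'i set \<Rightarrow> ('i \<Rightarrow> real) \<Rightarrow> 'i set" where
  "pos_indices J lam = {i\<in>J. 0 < lam i}"

lemma normal_cone_polyhedron:
  fixes a :: "'i \<Rightarrow> 'a::euclidean_space"
  assumes fin: "finite J" and x: "x \<in> {x. \<forall>i\<in>J. a i \<bullet> x \<le> b i}"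
  shows "normal_cone x {x. \<forall>i\<in>J. a i \<bullet> x \<le> b i} = convex_cone hull (a ` active a b J x)"
    (is "?N = ?K")
proof
  show "?K \<subseteq> ?N"
  proof (rule hull_minimal)
    show "a ` active a b J x \<subseteq> ?N"
      by (auto simp: normal_cone_def active_def inner_diff_right)
    show "convex_cone ?N"
      unfolding convex_cone_iff
      by (auto simp: normal_cone_def inner_add_left mult_nonneg_nonpos add_nonpos_nonpos)
  qed
  show "?N \<subseteq> ?K"
  proof
    fix v assume v: "v \<in> ?N"
    show "v \<in> ?K"
    proof (rule ccontr)
      assume nv: "v \<notin> ?K"
      have "finite (a ` active a b J x)" using fin by (simp add: active_def)
      then have "closed ?K" by (simp add: polyhedron_convex_cone_hull polyhedron_imp_closed)
      then obtain w c where w: "w \<bullet> v < c" "\<forall>k\<in>?K. w \<bullet> k > c"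
        using separating_hyperplane_closed_point[OF convex_convex_cone_hull _ nv] by blast
      have c: "c < 0" using w(2) convex_cone_hull_contains_0[of "a ` active a b J x"] by force
      have wk: "w \<bullet> k \<ge> 0" if k: "k \<in> ?K" for k
      proof (rule ccontr)
        assume "\<not> w \<bullet> k \<ge> 0"
        then have neg: "w \<bullet> k < 0" by simp
        then have "(c / (w \<bullet> k)) *\<^sub>R k \<in> ?K"
          using c by (intro convex_cone_hull_mul k) (simp add: divide_nonpos_nonpos)
        with w(2) have "w \<bullet> ((c / (w \<bullet> k)) *\<^sub>R k) > c" by blast
        with neg show False by simp
      qed
      have "\<forall>\<^sub>F t in at_right (0::real). \<forall>i\<in>J. a i \<bullet> (x - t *\<^sub>R w) \<le> b i"
      proof (rule eventually_ball_finite[OF fin], rule ballI)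
        fix i assume i: "i \<in> J"
        show "\<forall>\<^sub>F t in at_right (0::real). a i \<bullet> (x - t *\<^sub>R w) \<le> b i"
        proof (cases "i \<in> active a b J x")
          case True
          then have "a i \<in> ?K" by (simp add: hull_inc)
          then have "a i \<bullet> w \<ge> 0" using wk by (metis inner_commute)
          then have "a i \<bullet> (x - t *\<^sub>R w) \<le> b i" if "t > 0" for t
            using True that by (simp add: active_def inner_diff_right)
          then show ?thesis by (simp add: eventually_at_right_less eventually_mono[OF eventually_at_right_less])
        next
          case False
          then have lt: "a i \<bullet> x < b i" using i x by (force simp: active_def)
          have "((\<lambda>t. a i \<bullet> (x - t *\<^sub>R w)) \<longlongrightarrow> a i \<bullet> (x - 0 *\<^sub>R w)) (at_right 0)"
            by (intro tendsto_intros)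
          then have "\<forall>\<^sub>F t in at_right (0::real). a i \<bullet> (x - t *\<^sub>R w) < b i"
            using lt by (intro order_tendstoD(2)) auto
          then show ?thesis by (rule eventually_mono) simp
        qed
      qed
      then have "\<forall>\<^sub>F t in at_right (0::real). 0 < t \<and> (\<forall>i\<in>J. a i \<bullet> (x - t *\<^sub>R w) \<le> b i)"
        by (intro eventually_conj eventually_at_right_less)
      then obtain t where t: "0 < t" "\<forall>i\<in>J. a i \<bullet> (x - t *\<^sub>R w) \<le> b i"
        using eventually_happens'[OF trivial_limit_at_right_real] by blast
      then have "v \<bullet> ((x - t *\<^sub>R w) - x) \<le> 0" using v unfolding normal_cone_def by blast
      then have "v \<bullet> w \<ge> 0" using t(1) by (simp add: zero_le_mult_iff)
      then show False using w(1) c by (simp add: inner_commute)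
    qed
  qed
qed

lemma represents_exists:
  fixes a :: "'i \<Rightarrow> 'a::real_inner"
  assumes fin: "finite Q" and xs: "xs \<in> convex_cone hull (a ` Q)"
  shows "\<exists>J lam. represents a Q xs J lam"
proof -
  let ?S = "{xs. \<exists>lam. represents a Q xs Q lam}"
  have "convex_cone hull (a ` Q) \<subseteq> ?S"
  proof (rule hull_minimal)
    show "a ` Q \<subseteq> ?S"
    proof clarify
      fix i assume i: "i \<in> Q"
      have "(\<Sum>j\<in>Q. (if j = i then 1 else 0) *\<^sub>R a j) = (\<Sum>j\<in>Q. if j = i then a j else 0)"
        by (rule sum.cong) auto
      then show "\<exists>lam. represents a Q (a i) Q lam"
        using i fin by (intro exI[of _ "\<lambda>j. if j = i then 1 else 0"]) (simp add: represents_def)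
    qed
    have "\<exists>lam. represents a Q (x + y) Q lam" if "represents a Q x Q l" "represents a Q y Q m" for x y l m
      using that by (intro exI[of _ "\<lambda>i. l i + m i"])
        (simp add: represents_def scaleR_add_left sum.distrib)
    moreover have "\<exists>lam. represents a Q (c *\<^sub>R x) Q lam" if "represents a Q x Q l" "0 \<le> c" for x l c
      using that by (intro exI[of _ "\<lambda>i. c * l i"]) (simp add: represents_def scaleR_sum_right)
    moreover have "represents a Q 0 Q (\<lambda>_. 0)" by (simp add: represents_def)
    ultimately show "convex_cone ?S" unfolding convex_cone_iff by blast
  qed
  with xs show ?thesis by blast
qed

end

theory Submission
  imports Defs
begin

text \<open>
  Near \<open>(x, xs)\<close> the graph of \<open>\<N>\<close> behaves like a cone. Only finitely many cones, generated by the
  sets \<open>{a i | i \<in> K}\<close> with \<open>K\<close> contained in the active index set, occur as normal cones, and they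
  are closed. Hence, if \<open>(y, ys)\<close> in the graph is close to \<open>(x, xs)\<close>, then \<open>ys\<close> lies in the normal
  cone at \<open>x\<close> and, conversely, \<open>xs\<close> lies in the normal cone at \<open>y\<close>, so that \<open>xs\<close> is orthogonal to
  \<open>y - x\<close>. This makes \<open>\<langle>u, y - x\<rangle> + \<langle>v, ys - xs\<rangle>\<close> nonpositive when \<open>(u, v)\<close> is in the product on the
  right. The reverse inclusion tests a normal on three kinds of segments in the graph starting at
  \<open>(x, xs)\<close>: moving \<open>x\<close> along a tangent direction orthogonal to \<open>xs\<close>, moving \<open>xs\<close> along an active
  \<open>a i\<close>, and scaling \<open>xs\<close>. The description by index sets is Farkas' lemma.
\<close>

section \<open>Feasible directions and tangent cones of polyhedra\<close>

text \<open>Constraints active at \<open>x\<close> do not grow along \<open>w\<close>, and the slack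
  of the others survives a short step by continuity. As \<open>J\<close> is finite, one
  \<open>d\<close> serves all constraints.\<close>

lemma polyhedron_feasible_direction:
  fixes a :: "'i \<Rightarrow> 'a::real_inner"
  assumes fin: "finite J" and x: "\<forall>i\<in>J. a i \<bullet> x \<le> b i"
    and w: "w \<in> cone_T a (active a b J x)"
  obtains d where "0 < d" "\<And>t. 0 < t \<Longrightarrow> t < d \<Longrightarrow> \<forall>i\<in>J. a i \<bullet> (x + t *\<^sub>R w) \<le> b i"
proof -
  have "\<forall>\<^sub>F t in at_right (0::real). \<forall>i\<in>J. a i \<bullet> (x + t *\<^sub>R w) \<le> b i"
  proof (rule eventually_ball_finite[OF fin], rule ballI)
    fix i assume i: "i \<in> J"
    show "\<forall>\<^sub>F t in at_right (0::real). a i \<bullet> (x + t *\<^sub>R w) \<le> b i"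
    proof (cases "a i \<bullet> x = b i")
      case True
      then have "a i \<bullet> w \<le> 0" using i w by (simp add: active_def cone_T_def)
      then have "a i \<bullet> (x + t *\<^sub>R w) \<le> b i" if "t > 0" for t
        using True that by (simp add: inner_add_right mult_nonneg_nonpos)
      then show ?thesis by (simp add: eventually_mono[OF eventually_at_right_less])
    next
      case False
      then have lt: "a i \<bullet> x < b i" using i x by force
      have "((\<lambda>t. a i \<bullet> (x + t *\<^sub>R w)) \<longlongrightarrow> a i \<bullet> (x + 0 *\<^sub>R w)) (at_right 0)"
        by (intro tendsto_intros)
      then have "\<forall>\<^sub>F t in at_right (0::real). a i \<bullet> (x + t *\<^sub>R w) < b i"
        using lt by (intro order_tendstoD(2)) auto
      then show ?thesis by (rule eventually_mono) simp
    qed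
  qed
  then show thesis
    using that unfolding eventually_at_right_field by blast
qed

text \<open>For an active constraint \<open>b i\<close> cancels, division by \<open>t k\<close>
  leaves \<open>a i \<bullet> v k \<le> 0\<close>, and this passes to the limit. Conversely, the
  constant sequence \<open>w\<close> with short steps is a witness.\<close>

lemma tangent_cone_polyhedron:
  fixes a :: "'i \<Rightarrow> 'a::real_inner"
  assumes fin: "finite J" and x: "\<forall>i\<in>J. a i \<bullet> x \<le> b i"
  shows "tangent_cone x {y. \<forall>i\<in>J. a i \<bullet> y \<le> b i} = cone_T a (active a b J x)"
proof (intro equalityI subsetI)
  fix w assume "w \<in> tangent_cone x {y. \<forall>i\<in>J. a i \<bullet> y \<le> b i}"
  then obtain t :: "nat \<Rightarrow> real" and v where t: "\<And>k. 0 < t k" and v: "v \<longlonglongrightarrow> w"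
    and mem: "\<And>k i. i \<in> J \<Longrightarrow> a i \<bullet> (x + t k *\<^sub>R v k) \<le> b i"
    unfolding tangent_cone_def by blast
  have "a i \<bullet> w \<le> 0" if i: "i \<in> J" "a i \<bullet> x = b i" for i
  proof (rule LIMSEQ_le_const2)
    show "(\<lambda>k. a i \<bullet> v k) \<longlonglongrightarrow> a i \<bullet> w" by (intro tendsto_intros v)
    have "a i \<bullet> v k \<le> 0" for k
      using mem[OF i(1), of k] i(2) t[of k] by (simp add: inner_add_right mult_le_0_iff)
    then show "\<exists>N. \<forall>k\<ge>N. a i \<bullet> v k \<le> 0" by blast
  qed
  then show "w \<in> cone_T a (active a b J x)" by (simp add: cone_T_def active_def)
next
  fix w assume "w \<in> cone_T a (active a b J x)"
  with fin x obtain d where d: "0 < d"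
    "\<And>t. 0 < t \<Longrightarrow> t < d \<Longrightarrow> \<forall>i\<in>J. a i \<bullet> (x + t *\<^sub>R w) \<le> b i"
    by (rule polyhedron_feasible_direction) blast
  \<comment> \<open>Feasibility is known only on the open interval up to \<open>d\<close>; the
    factor 1/2 keeps the term for \<open>k = 0\<close> strictly below \<open>d\<close> as
    well.\<close>
  let ?t = "\<lambda>k. d / 2 * inverse (real (Suc k))"
  have "?t \<longlonglongrightarrow> d / 2 * 0" by (intro tendsto_intros LIMSEQ_inverse_real_of_nat)
  moreover have pos: "0 < ?t k" for k using d(1) by simp
  moreover have "?t k < d" for k
  proof -
    have "inverse (real (Suc k)) \<le> 1" by (simp add: inverse_le_1_iff)
    then have "?t k \<le> d / 2 * 1" using d(1) by (intro mult_left_mono) auto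
    then show ?thesis using d(1) by simp
  qed
  ultimately show "w \<in> tangent_cone x {y. \<forall>i\<in>J. a i \<bullet> y \<le> b i}"
    unfolding tangent_cone_def using d(2)
    by (intro CollectI exI[of _ ?t] exI[of _ "\<lambda>_. w"]) auto
qed

section \<open>Testing the upper limit along segments\<close>

text \<open>Along \<open>z + t *\<^sub>R w\<close> with \<open>t > 0\<close> the quotient does not
  depend on \<open>t\<close>, so a positive value would persist arbitrarily close to
  \<open>z\<close>.\<close>

lemma Limsup_frechet_quotient_nonposD:
  fixes zs :: "'a::real_inner"
  assumes lim: "Limsup (at z within S) (\<lambda>y. ereal ((zs \<bullet> (y - z)) / norm (y - z))) \<le> 0"
    and d: "0 < d" "\<And>t. 0 < t \<Longrightarrow> t < d \<Longrightarrow> z + t *\<^sub>R w \<in> S"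
  shows "zs \<bullet> w \<le> 0"
proof (rule ccontr)
  assume "\<not> zs \<bullet> w \<le> 0"
  then have pos: "0 < zs \<bullet> w" by simp
  then have w0: "w \<noteq> 0" by auto
  \<comment> \<open>This is the value of the quotient at every point of the segment other than
    \<open>z\<close>; the contradiction is that it would have to be strictly below itself.\<close>
  define c where "c = (zs \<bullet> w) / norm w"
  have c: "0 < c" using pos w0 by (simp add: c_def)
  then have "Limsup (at z within S) (\<lambda>y. ereal ((zs \<bullet> (y - z)) / norm (y - z))) < ereal c"
    using lim by (metis ereal_less(2) le_less_trans)
  then have "\<forall>\<^sub>F y in at z within S. ereal ((zs \<bullet> (y - z)) / norm (y - z)) < ereal c"
    by (rule Limsup_lessD)
  then obtain e where e: "0 < e"
    "\<And>y. y \<in> S \<Longrightarrow> y \<noteq> z \<Longrightarrow> dist y z < e \<Longrightarrow> (zs \<bullet> (y - z)) / norm (y - z) < c"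
    unfolding eventually_at by auto
  define t where "t = min d (e / norm w) / 2"
  have t: "0 < t" "t < d" "t * norm w < e"
  proof -
    show "0 < t" "t < d" using d(1) e(1) w0 by (auto simp: t_def min_def)
    have "t < e / norm w" using d(1) e(1) w0 by (auto simp: t_def min_def field_simps)
    then show "t * norm w < e" using w0 by (simp add: pos_less_divide_eq)
  qed
  have "(zs \<bullet> (z + t *\<^sub>R w - z)) / norm (z + t *\<^sub>R w - z) < c"
    using t w0 by (intro e(2) d(2)) (auto simp: dist_norm)
  then show False using t(1) by (simp add: c_def)
qed

lemma Limsup_frechet_quotient_nonposI:
  fixes zs :: "'a::real_inner"
  assumes "\<forall>\<^sub>F y in at z within S. zs \<bullet> (y - z) \<le> 0"
  shows "Limsup (at z within S) (\<lambda>y. ereal ((zs \<bullet> (y - z)) / norm (y - z))) \<le> 0"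
  by (rule Limsup_bounded, rule eventually_mono[OF assms]) (simp add: divide_nonpos_nonneg)

section \<open>Local structure of the graph of the normal cone mapping\<close>

lemma eventually_active_subset:
  fixes a :: "'i \<Rightarrow> 'a::real_inner"
  assumes "finite J"
  shows "\<forall>\<^sub>F y in nhds x. active a b J y \<subseteq> active a b J x"
proof -
  have "\<forall>\<^sub>F y in nhds x. \<forall>i\<in>J. a i \<bullet> x \<noteq> b i \<longrightarrow> a i \<bullet> y \<noteq> b i"
  proof (rule eventually_ball_finite[OF assms], rule ballI)
    fix i
    have "((\<lambda>y. a i \<bullet> y) \<longlongrightarrow> a i \<bullet> x) (nhds x)"
      by (intro tendsto_intros filterlim_ident)
    then have "\<forall>\<^sub>F y in nhds x. a i \<bullet> y \<noteq> b i" if "a i \<bullet> x \<noteq> b i"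
      using that by (rule tendsto_imp_eventually_ne)
    then show "\<forall>\<^sub>F y in nhds x. a i \<bullet> x \<noteq> b i \<longrightarrow> a i \<bullet> y \<noteq> b i" by simp
  qed
  then show ?thesis by (rule eventually_mono) (auto simp: active_def)
qed

text \<open>A finitely generated cone is closed, so if it misses \<open>xs\<close> it misses a
  neighbourhood of \<open>xs\<close>. There are finitely many \<open>K\<close>, hence one
  neighbourhood works for all of them, whatever active set occurs later.\<close>

lemma eventually_generated_cones_contain:
  fixes a :: "'i \<Rightarrow> 'a::euclidean_space"
  assumes "finite J"
  shows "\<forall>\<^sub>F ys in nhds xs. \<forall>K\<in>Pow J.
           ys \<in> convex_cone hull (a ` K) \<longrightarrow> xs \<in> convex_cone hull (a ` K)"
proof (rule eventually_ball_finite)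
  show "finite (Pow J)" using assms by simp
  show "\<forall>K\<in>Pow J. \<forall>\<^sub>F ys in nhds xs.
           ys \<in> convex_cone hull (a ` K) \<longrightarrow> xs \<in> convex_cone hull (a ` K)"
  proof
    fix K assume "K \<in> Pow J"
    then have "finite (a ` K)" using assms by (auto intro: finite_subset)
    then have "closed (convex_cone hull (a ` K))"
      by (simp add: polyhedron_convex_cone_hull polyhedron_imp_closed)
    then have "\<forall>\<^sub>F ys in nhds xs. ys \<in> - (convex_cone hull (a ` K))"
      if "xs \<notin> convex_cone hull (a ` K)"
      using that by (intro eventually_nhds_in_open) auto
    then show "\<forall>\<^sub>F ys in nhds xs.
           ys \<in> convex_cone hull (a ` K) \<longrightarrow> xs \<in> convex_cone hull (a ` K)"
      by (cases "xs \<in> convex_cone hull (a ` K)") auto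
  qed
qed

lemma convex_cone_hull_inner_nonpos:
  fixes v :: "'a::real_inner"
  assumes "k \<in> convex_cone hull S" and "\<And>s. s \<in> S \<Longrightarrow> s \<bullet> v \<le> 0"
  shows "k \<bullet> v \<le> 0"
proof -
  have "convex_cone hull S \<subseteq> {k. k \<bullet> v \<le> 0}"
    using assms(2)
    by (intro hull_minimal)
      (auto simp: convex_cone_iff inner_add_left mult_nonneg_nonpos add_nonpos_nonpos)
  with assms(1) show ?thesis by blast
qed

text \<open>The normal cone at \<open>y\<close> is generated by the \<open>a i\<close> active at
  \<open>y\<close>. Being one of the finitely many closed cones, it contains \<open>xs\<close> once
  it contains a nearby \<open>ys\<close>; since no new constraint becomes active near
  \<open>x\<close>, it lies in the normal cone at \<open>x\<close>.\<close>

lemma normal_cone_graph_locally: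
  fixes a :: "'i \<Rightarrow> 'a::euclidean_space"
  assumes fin: "finite J" and \<Theta>: "\<Theta> = {y. \<forall>i\<in>J. a i \<bullet> y \<le> b i}" and x: "x \<in> \<Theta>"
  shows "\<forall>\<^sub>F (y, ys) in nhds (x, xs). (y, ys) \<in> gph (normal_cone_map \<Theta>) \<longrightarrow>
           xs \<in> normal_cone y \<Theta> \<and> ys \<in> normal_cone x \<Theta>"
proof -
  have "\<forall>\<^sub>F z in nhds x \<times>\<^sub>F nhds xs. active a b J (fst z) \<subseteq> active a b J x \<and>
          (\<forall>K\<in>Pow J. snd z \<in> convex_cone hull (a ` K) \<longrightarrow> xs \<in> convex_cone hull (a ` K))"
    using eventually_prodI[OF eventually_active_subset[OF fin, of a b x]
        eventually_generated_cones_contain[OF fin, of a xs]] by simp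
  then have "\<forall>\<^sub>F z in nhds (x, xs). active a b J (fst z) \<subseteq> active a b J x \<and>
          (\<forall>K\<in>Pow J. snd z \<in> convex_cone hull (a ` K) \<longrightarrow> xs \<in> convex_cone hull (a ` K))"
    by (simp add: nhds_prod)
  then show ?thesis
  proof (rule eventually_mono, clarsimp)
    fix y ys
    assume act: "active a b J y \<subseteq> active a b J x"
      and cones: "\<forall>K\<in>Pow J. ys \<in> convex_cone hull (a ` K) \<longrightarrow> xs \<in> convex_cone hull (a ` K)"
      and "(y, ys) \<in> gph (normal_cone_map \<Theta>)"
    then have y: "y \<in> \<Theta>" and ys: "ys \<in> normal_cone y \<Theta>"
      by (auto simp: gph_def normal_cone_map_def split: if_splits)
    have hull: "normal_cone z \<Theta> = convex_cone hull (a ` active a b J z)" if "z \<in> \<Theta>" for z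
      using normal_cone_polyhedron[OF fin] that unfolding \<Theta> .
    have "active a b J y \<in> Pow J" by (auto simp: active_def)
    then have "xs \<in> normal_cone y \<Theta>" using cones ys hull[OF y] by blast
    moreover have "ys \<in> normal_cone x \<Theta>"
      using ys hull[OF x] hull[OF y] hull_mono[OF image_mono[OF act, of a], of convex_cone] by auto
    ultimately show "xs \<in> normal_cone y \<Theta> \<and> ys \<in> normal_cone x \<Theta>" ..
  qed
qed

section \<open>Farkas' lemma and the cones given by index sets\<close>

text \<open>The polar of a polyhedral cone is its normal cone at 0, where all the homogeneous
  constraints are active.\<close>

lemma polar_finite_inequalities:
  fixes G :: "'a::euclidean_space set"
  assumes "finite G"
  shows "polar {u. \<forall>g\<in>G. g \<bullet> u \<le> 0} = convex_cone hull G"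
  using normal_cone_polyhedron[OF assms, of 0 "\<lambda>g. g" "\<lambda>_. 0"]
  by (simp add: normal_cone_def polar_def active_def)

lemma convex_cone_cone_A: "convex_cone (cone_A a Q P)"
proof -
  have "convex_cone (span (a ` P))"
    by (auto simp: convex_cone_iff span_add span_scale span_zero)
  moreover have "convex_cone (convex_cone hull (a ` (Q - P)))"
    by (rule convex_cone_convex_cone_hull)
  ultimately have "convex_cone (\<Union>k \<in> convex_cone hull (a ` (Q - P)). \<Union>m \<in> span (a ` P). {k + m})"
    by (intro convex_cone_sums)
  moreover have "(\<Union>k \<in> convex_cone hull (a ` (Q - P)). \<Union>m \<in> span (a ` P). {k + m}) = cone_A a Q P"
    by (auto simp: cone_A_def set_plus_def)
  ultimately show ?thesis by simp
qed

text \<open>Each equation for an index in \<open>P\<close> is a pair of opposite inequalities, so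
  Farkas' lemma gives the cone generated by \<open>a\<close> Q\<open>and the negatives of\<close>a
  \<open>P\<close>. Both signs together produce the span in \<open>cone_A\<close>.\<close>

lemma polar_cone_B:
  fixes a :: "'i \<Rightarrow> 'a::euclidean_space"
  assumes fin: "finite Q" and sub: "P \<subseteq> Q"
  shows "polar (cone_B a Q P) = cone_A a Q P"
proof
  let ?G = "a ` Q \<union> uminus ` a ` P"
  have eq: "cone_B a Q P = {u. \<forall>g\<in>?G. g \<bullet> u \<le> 0}"
    using sub by (auto simp: cone_B_def cone_T_def ball_Un intro!: antisym)
  have "finite ?G" using fin sub by (simp add: finite_subset)
  then have "polar (cone_B a Q P) = convex_cone hull ?G"
    unfolding eq by (rule polar_finite_inequalities)
  also have "\<dots> \<subseteq> cone_A a Q P"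
  proof (intro hull_minimal convex_cone_cone_A)
    have hull0: "0 \<in> convex_cone hull (a ` (Q - P))" by (rule convex_cone_hull_contains_0)
    have *: "s \<in> cone_A a Q P" if "s \<in> span (a ` P)" for s
      using set_plus_intro[OF hull0 that] by (simp add: cone_A_def)
    have **: "s \<in> cone_A a Q P" if "s \<in> a ` (Q - P)" for s
      using set_plus_intro[OF hull_inc[OF that] span_zero] by (simp add: cone_A_def)
    have "a i \<in> cone_A a Q P" if "i \<in> Q" for i
      using that by (cases "i \<in> P") (auto intro: * ** span_base)
    then show "?G \<subseteq> cone_A a Q P"
      by (auto intro: * span_base span_neg)
  qed
  finally show "polar (cone_B a Q P) \<subseteq> cone_A a Q P" .
  show "cone_A a Q P \<subseteq> polar (cone_B a Q P)"
  proof
    fix s assume "s \<in> cone_A a Q P"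
    then obtain k m where s: "s = k + m" and k: "k \<in> convex_cone hull (a ` (Q - P))"
      and m: "m \<in> span (a ` P)"
      unfolding cone_A_def by (rule set_plus_elim)
    have "s \<bullet> u \<le> 0" if u: "u \<in> cone_B a Q P" for u
    proof -
      have "k \<bullet> u \<le> 0"
        using k by (rule convex_cone_hull_inner_nonpos) (use u in \<open>auto simp: cone_B_def cone_T_def\<close>)
      moreover have "orthogonal u m"
        using m by (rule orthogonal_to_span)
          (use u in \<open>auto simp: cone_B_def orthogonal_def inner_commute\<close>)
      then have "m \<bullet> u = 0" by (simp add: orthogonal_def inner_commute)
      ultimately show ?thesis by (simp add: s inner_add_left)
    qed
    then show "s \<in> polar (cone_B a Q P)" by (simp add: polar_def)
  qed
qed

text \<open>On \<open>cone_T a Q\<close> all terms \<open>lam i * (a i \<bullet> u)\<close> are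
  nonpositive, so their sum vanishes only if each does. Allowing \<open>R \<subseteq> Q\<close> lets
  a representation of \<open>xs\<close> by constraints of \<open>\<Theta>\<close> serve for
  \<open>\<Theta> \<inter> C\<close> too.\<close>

lemma cone_T_Int_orth:
  fixes a :: "'i \<Rightarrow> 'a::real_inner"
  assumes fin: "finite Q" and rep: "represents a R xs J lam" and "R \<subseteq> Q"
  shows "cone_T a Q \<inter> orth xs = cone_B a Q (pos_indices J lam)"
proof -
  have J: "J \<subseteq> Q" "\<And>i. i \<in> J \<Longrightarrow> 0 \<le> lam i" and xs: "xs = (\<Sum>i\<in>J. lam i *\<^sub>R a i)"
    using rep \<open>R \<subseteq> Q\<close> by (auto simp: represents_def)
  have finJ: "finite J" using J(1) fin by (rule finite_subset)
  have "u \<in> orth xs \<longleftrightarrow> (\<forall>i\<in>pos_indices J lam. a i \<bullet> u = 0)" if u: "u \<in> cone_T a Q" for u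
  proof -
    have "lam i * (a i \<bullet> u) \<le> 0" if "i \<in> J" for i
      using that u J by (auto simp: cone_T_def intro: mult_nonneg_nonpos)
    then have "(\<Sum>i\<in>J. lam i * (a i \<bullet> u)) = 0 \<longleftrightarrow> (\<forall>i\<in>J. lam i * (a i \<bullet> u) = 0)"
      using sum_nonneg_eq_0_iff[OF finJ, of "\<lambda>i. - (lam i * (a i \<bullet> u))"]
      by (simp add: sum_negf)
    also have "\<dots> \<longleftrightarrow> (\<forall>i\<in>pos_indices J lam. a i \<bullet> u = 0)"
      using J(2) by (fastforce simp: pos_indices_def)
    finally show ?thesis by (simp add: orth_def xs inner_sum_left)
  qed
  then show ?thesis by (auto simp: cone_B_def)
qed

theorem theorem3p1:
  fixes a :: "nat \<Rightarrow> real ^ 'n" and b :: "nat \<Rightarrow> real" and l1 l :: nat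
    and I1 I2 :: "nat set" and \<Theta> C :: "(real ^ 'n) set" and x xs :: "real ^ 'n"
  assumes "l1 \<le> l"
    and "I1 = {1..l1}" and "I2 = {l1+1..l}"
    and "\<Theta> = {y. \<forall>i\<in>I1. a i \<bullet> y \<le> b i}"
    and "C = {y. \<forall>i\<in>I2. a i \<bullet> y \<le> 0}"
    and "x \<in> C" and "(x, xs) \<in> gph (normal_cone_map \<Theta>)"
  shows "frechet_normal_cone_wrt (C \<times> UNIV) (x, xs) (gph (normal_cone_map \<Theta>))
       = (polar (tangent_cone x (\<Theta> \<inter> C) \<inter> orth xs) \<inter> tangent_cone x C)
         \<times> (tangent_cone x \<Theta> \<inter> orth xs)
    \<and> (\<forall>J lam. represents a (active a b I1 x) xs J lam \<longrightarrow>
         (polar (tangent_cone x (\<Theta> \<inter> C) \<inter> orth xs) \<inter> tangent_cone x C)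
         \<times> (tangent_cone x \<Theta> \<inter> orth xs)
       = (cone_A a (active a b I1 x \<union> active a (\<lambda>_. 0) I2 x) (pos_indices J lam)
            \<inter> cone_T a (active a (\<lambda>_. 0) I2 x))
         \<times> cone_B a (active a b I1 x) (pos_indices J lam))"
proof -

  \<comment> \<open>Tangent and normal cones at the reference point\<close>
  let ?A1 = "active a b I1 x" and ?A2 = "active a (\<lambda>_. 0) I2 x"
  let ?S = "gph (normal_cone_map \<Theta>) \<inter> (C \<times> UNIV)"
  \<comment> \<open>Right-hand sides that present \<open>\<Theta> \<inter> C\<close> as a single
    polyhedron over \<open>I1 \<union> I2\<close>.\<close>
  define b' where "b' = (\<lambda>i. if i \<in> I1 then b i else 0)"
  have fin: "finite I1" "finite I2" "finite (I1 \<union> I2)" and disj: "I1 \<inter> I2 = {}"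
    using assms(2,3) by auto
  note \<Theta> = assms(4) and C = assms(5)
  have x\<Theta>: "x \<in> \<Theta>" and xs: "xs \<in> normal_cone x \<Theta>"
    using assms(7) by (auto simp: gph_def normal_cone_map_def split: if_splits)
  have x1: "\<forall>i\<in>I1. a i \<bullet> x \<le> b i" and x2: "\<forall>i\<in>I2. a i \<bullet> x \<le> 0"
    using x\<Theta> assms(6) \<Theta> C by auto
  have \<Theta>C: "\<Theta> \<inter> C = {y. \<forall>i\<in>I1 \<union> I2. a i \<bullet> y \<le> b' i}"
    using disj by (auto simp: \<Theta> C b'_def)
  have x12: "\<forall>i\<in>I1 \<union> I2. a i \<bullet> x \<le> b' i" using x\<Theta> assms(6) \<Theta>C by blast
  have act: "active a b' (I1 \<union> I2) x = ?A1 \<union> ?A2"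
    using disj by (auto simp: active_def b'_def)
  have T\<Theta>: "tangent_cone x \<Theta> = cone_T a ?A1"
    unfolding \<Theta> by (rule tangent_cone_polyhedron[OF fin(1) x1])
  have TC: "tangent_cone x C = cone_T a ?A2"
    unfolding C by (rule tangent_cone_polyhedron[OF fin(2) x2])
  have T\<Theta>C: "tangent_cone x (\<Theta> \<inter> C) = cone_T a (?A1 \<union> ?A2)"
    unfolding \<Theta>C act[symmetric] by (rule tangent_cone_polyhedron[OF fin(3) x12])
  have hull: "normal_cone x \<Theta> = convex_cone hull (a ` ?A1)"
    using normal_cone_polyhedron[OF fin(1)] x\<Theta> unfolding \<Theta> .
  have finA: "finite ?A1" "finite (?A1 \<union> ?A2)" using fin by (auto simp: active_def)

  \<comment> \<open>The Frechet normal cone as a product\<close>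
  have "frechet_normal_cone_wrt (C \<times> UNIV) (x, xs) (gph (normal_cone_map \<Theta>))
       = (polar (tangent_cone x (\<Theta> \<inter> C) \<inter> orth xs) \<inter> tangent_cone x C)
         \<times> (tangent_cone x \<Theta> \<inter> orth xs)" (is "?F = ?R")
  proof (intro equalityI subsetI)
    fix uv assume F: "uv \<in> ?F"
    obtain u v where uv: "uv = (u, v)" by (cases uv)
    from F uv obtain p where p: "0 < p" "x + p *\<^sub>R u \<in> C"
      and lim: "Limsup (at (x, xs) within ?S)
          (\<lambda>y. ereal (((u, v) \<bullet> (y - (x, xs))) / norm (y - (x, xs)))) \<le> 0"
      by (auto simp: frechet_normal_cone_wrt_def)
    note test = Limsup_frechet_quotient_nonposD[OF lim]
    \<comment> \<open>This factor comes from the point \<open>x + p *\<^sub>R u\<close> in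
      \<open>C\<close>; the upper limit yields the polar and the second factor.\<close>
    have "u \<in> tangent_cone x C"
      unfolding TC cone_T_def
    proof clarify
      fix i assume "i \<in> ?A2"
      then have "p * (a i \<bullet> u) \<le> 0"
        using p(2) C by (auto simp: active_def inner_add_right)
      then show "a i \<bullet> u \<le> 0" using p(1) by (simp add: mult_le_0_iff)
    qed
    moreover have "u \<bullet> w \<le> 0" if w: "w \<in> tangent_cone x (\<Theta> \<inter> C)" "w \<in> orth xs" for w
    proof -
      have "w \<in> cone_T a (active a b' (I1 \<union> I2) x)" using w(1) T\<Theta>C act by simp
      with fin(3) x12 obtain d where d: "0 < d"
        "\<And>t. 0 < t \<Longrightarrow> t < d \<Longrightarrow> \<forall>i\<in>I1 \<union> I2. a i \<bullet> (x + t *\<^sub>R w) \<le> b' i"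
        by (rule polyhedron_feasible_direction) blast
      have "(x, xs) + t *\<^sub>R (w, 0) \<in> ?S" if t: "0 < t" "t < d" for t
      proof -
        have "x + t *\<^sub>R w \<in> \<Theta> \<inter> C" using d(2)[OF t] \<Theta>C by blast
        \<comment> \<open>Moving the base point orthogonally to \<open>xs\<close> leaves the
          defining inequalities of normality unchanged.\<close>
        moreover have "xs \<in> normal_cone (x + t *\<^sub>R w) \<Theta>"
          using xs w(2) by (auto simp: normal_cone_def orth_def inner_diff_right inner_add_right)
        ultimately show ?thesis by (auto simp: gph_def normal_cone_map_def)
      qed
      from test[OF d(1) this] show ?thesis by simp
    qed
    moreover have v_test: "v \<bullet> w \<le> 0"
      if d: "0 < d" and seg: "\<And>t. 0 < t \<Longrightarrow> t < d \<Longrightarrow> xs + t *\<^sub>R w \<in> normal_cone x \<Theta>"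
      for w d
    proof -
      have "(x, xs) + t *\<^sub>R (0, w) \<in> ?S" if "0 < t" "t < d" for t
        using that x\<Theta> assms(6) seg by (auto simp: gph_def normal_cone_map_def)
      from test[OF d this] show ?thesis by simp
    qed
    have "v \<in> tangent_cone x \<Theta>"
      unfolding T\<Theta> cone_T_def
    proof clarify
      fix i assume "i \<in> ?A1"
      then have "xs + t *\<^sub>R a i \<in> normal_cone x \<Theta>" if "0 < t" for t
        using that xs unfolding hull
        by (intro convex_cone_hull_add convex_cone_hull_mul) (auto intro: hull_inc)
      then show "a i \<bullet> v \<le> 0" using v_test[of 1 "a i"] by (simp add: inner_commute)
    qed
    moreover have "v \<in> orth xs"
    proof -
      \<comment> \<open>Scaling by factors above and below 1 makes both \<open>xs\<close> and
        \<open>- xs\<close> admissible test directions, which forces equality.\<close>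
      have scale: "c *\<^sub>R xs \<in> normal_cone x \<Theta>" if "0 \<le> c" for c
        using that xs unfolding hull by (rule_tac convex_cone_hull_mul)
      have "xs + t *\<^sub>R xs \<in> normal_cone x \<Theta>" if "0 < t" for t
        using scale[of "1 + t"] that by (simp add: scaleR_add_left)
      then have "v \<bullet> xs \<le> 0" using v_test[of 1 xs] by simp
      moreover have "xs + t *\<^sub>R (- xs) \<in> normal_cone x \<Theta>" if "0 < t" "t < 1" for t
        using scale[of "1 - t"] that by (simp add: scaleR_diff_left)
      then have "v \<bullet> (- xs) \<le> 0" using v_test[of 1 "- xs"] by simp
      ultimately show ?thesis by (simp add: orth_def inner_commute)
    qed
    ultimately show "uv \<in> ?R" by (auto simp: uv polar_def)
  next
    fix uv assume R: "uv \<in> ?R"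
    obtain u v where uv: "uv = (u, v)" by (cases uv)
    have u: "u \<in> polar (cone_T a (?A1 \<union> ?A2) \<inter> orth xs)" and uC: "u \<in> cone_T a ?A2"
      and v: "v \<in> cone_T a ?A1" "v \<in> orth xs"
      using R by (auto simp: uv T\<Theta> TC T\<Theta>C)
    obtain d where d: "0 < d" "\<And>t. 0 < t \<Longrightarrow> t < d \<Longrightarrow> \<forall>i\<in>I2. a i \<bullet> (x + t *\<^sub>R u) \<le> 0"
      using fin(2) x2 uC by (rule polyhedron_feasible_direction) blast
    have "x + (d / 2) *\<^sub>R u \<in> C" using d(1) d(2)[of "d / 2"] by (simp add: C)
    then have ex: "\<exists>p>0. (x, xs) + p *\<^sub>R uv \<in> C \<times> UNIV"
      using d(1) by (intro exI[of _ "d / 2"]) (simp add: uv)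
    have "\<forall>\<^sub>F z in nhds (x, xs). z \<in> ?S \<longrightarrow> uv \<bullet> (z - (x, xs)) \<le> 0"
      using normal_cone_graph_locally[OF fin(1) \<Theta> x\<Theta>, of xs]
    proof (rule eventually_mono, clarsimp)
      fix y ys
      assume xsy: "xs \<in> normal_cone y \<Theta>" and ysx: "ys \<in> normal_cone x \<Theta>"
        and g: "(y, ys) \<in> gph (normal_cone_map \<Theta>)" and yC: "y \<in> C"
      have y\<Theta>: "y \<in> \<Theta>" using g by (auto simp: gph_def normal_cone_map_def split: if_splits)
      \<comment> \<open>Normality of \<open>xs\<close> at \<open>y\<close>, tested at
        \<open>x\<close>, and at \<open>x\<close>, tested at \<open>y\<close>, gives opposite
        inequalities, hence orthogonality to \<open>y - x\<close>.\<close>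
      have "xs \<bullet> (x - y) \<le> 0" using xsy x\<Theta> by (simp add: normal_cone_def)
      moreover have "xs \<bullet> (y - x) \<le> 0" using xs y\<Theta> by (simp add: normal_cone_def)
      ultimately have "y - x \<in> orth xs" by (simp add: orth_def inner_diff_right)
      moreover have "y - x \<in> cone_T a (?A1 \<union> ?A2)"
        using y\<Theta> yC by (auto simp: \<Theta> C cone_T_def active_def inner_diff_right)
      ultimately have "u \<bullet> (y - x) \<le> 0" using u by (simp add: polar_def)
      moreover have "ys \<bullet> v \<le> 0"
        using ysx v(1) unfolding hull
        by (rule_tac convex_cone_hull_inner_nonpos) (auto simp: cone_T_def)
      \<comment> \<open>Subtracting \<open>xs\<close> changes nothing because \<open>v\<close> is
        orthogonal to it.\<close>
      then have "v \<bullet> (ys - xs) \<le> 0"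
        using v(2) by (simp add: orth_def inner_diff_right inner_commute)
      ultimately show "uv \<bullet> (y - x, ys - xs) \<le> 0" by (simp add: uv)
    qed
    then have "\<forall>\<^sub>F z in at (x, xs) within ?S. uv \<bullet> (z - (x, xs)) \<le> 0"
      unfolding eventually_at_filter by (rule eventually_mono) simp
    from Limsup_frechet_quotient_nonposI[OF this] ex show "uv \<in> ?F"
      by (simp add: frechet_normal_cone_wrt_def)
  qed

  \<comment> \<open>Description by index sets\<close>
  moreover have "?R = (cone_A a (?A1 \<union> ?A2) (pos_indices J lam) \<inter> cone_T a ?A2)
      \<times> cone_B a ?A1 (pos_indices J lam)"
    if rep: "represents a ?A1 xs J lam" for J lam
  proof -
    have "pos_indices J lam \<subseteq> ?A1 \<union> ?A2"
      using rep by (auto simp: represents_def pos_indices_def)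
    \<comment> \<open>The same \<open>J\<close> and \<open>lam\<close> are used twice: over
      \<open>?A1\<close> for the second factor, and over \<open>?A1 \<union> ?A2\<close>, followed
      by polarity, for the first.\<close>
    from polar_cone_B[OF finA(2) this, of a] show ?thesis
      using cone_T_Int_orth[OF finA(1) rep] cone_T_Int_orth[OF finA(2) rep]
      by (simp add: T\<Theta> TC T\<Theta>C)
  qed
  ultimately show ?thesis by blast
qed

end
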